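(* Let $w=(x_1,x_2,x_3;\lambda_1,\lambda_2,\lambda_3)\in\mathbb{O}^3\times\mathbb{R}^3$ be non-zero and let $$X=\begin{pmatrix}\lambda_1 & x_3 & \overline{x}_2\\ \overline{x}_3 & \lambda_2 & x_1\\ x_2 & \overline{x}_1 & \lambda_3\end{pmatrix}\in\mathfrak{J}_3(\mathbb{O})$$ be the corresponding Hermitian octonionic matrix. Then $w$ is a Veronese vector if and only if $X^{\sharp}=0$; that is, $w$ is a Veronese vector if and only if $X$ is an element of rank $1$ of the exceptional Jordan algebra $\mathfrak{J}_3(\mathbb{O})$.
   Context: $\mathbb{O}$ is the real division algebra of octonions, with conjugation $x\mapsto\overline{x}$ and norm $\|x\|^2=\overline{x}x$. $\mathfrak{J}_3(\mathbb{O})$ is the exceptional Jordan algebra of $3\times 3$ Hermitian octonionic matrices with product $X\circ Y=\frac12(XY+YX)$. A vector $w=(x_1,x_2,x_3;\lambda_1,\lambda_2,\lambda_3)\in \mathbb{O}^3\times\mathbb{R}^3$ is called Veronese if $$\lambda_1\overline{x}_1=x_2x_3,\quad \lambda_2\overline{x}_2=x_3x_1,\quad \lambda_3\overline{x}_3=x_1x_2,$$ $$\|x_1\|^2=\lambda_2\lambda_3,\quad \|x_2\|^2=\lambda_3\lambda_1,\quad \|x_3\|^2=\lambda_1\lambda_2.$$ The adjoint ($\sharp$-map) of the matrix $X$ corresponding to $w$ is $$X^{\sharp}=\begin{pmatrix}\lambda_2\lambda_3-\|x_1\|^2 & \overline{x_2}\,\overline{x_1}-\lambda_3x_3 & x_3x_1-\lambda_2\overline{x_2}\\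 x_1x_2-\lambda_3\overline{x_3} & \lambda_1\lambda_3-\|x_2\|^2 & \overline{x_3}\,\overline{x_2}-\lambda_1x_1\\ \overline{x_1}\,\overline{x_3}-\lambda_2x_2 & x_2x_3-\lambda_1\overline{x_1} & \lambda_1\lambda_2-\|x_3\|^2\end{pmatrix}.$$ An element $X\in\mathfrak{J}_3(\mathbb{O})$ has rank $1$ if $X\neq 0$ and $X^{\sharp}=0$. *)

theory Defs
  imports "HOL-Analysis.Analysis"
begin

text \<open>The basis elements satisfy \<open>e\<^sub>i e\<^sub>i = -1\<close> and \<open>e\<^sub>i e\<^sub>i\<^sub>+\<^sub>1 = e\<^sub>i\<^sub>+\<^sub>3\<close> for \<open>i\<close> in
  \<open>1, \<dots>, 7\<close> with indices mod 7, and each \<open>(e\<^sub>i, e\<^sub>i\<^sub>+\<^sub>1, e\<^sub>i\<^sub>+\<^sub>3)\<close> is a quaternionic triple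
  \<open>(i, j, k)\<close>.\<close>

datatype octonion =
  Octonion (oc0: real) (oc1: real) (oc2: real) (oc3: real)
           (oc4: real) (oc5: real) (oc6: real) (oc7: real)

lemma octonion_eq_iff:
  "x = y \<longleftrightarrow> oc0 x = oc0 y \<and> oc1 x = oc1 y \<and> oc2 x = oc2 y \<and> oc3 x = oc3 y \<and>
     oc4 x = oc4 y \<and> oc5 x = oc5 y \<and> oc6 x = oc6 y \<and> oc7 x = oc7 y"
  by (cases x; cases y) simp

definition oconj :: "octonion \<Rightarrow> octonion" where
  "oconj x = Octonion (oc0 x) (- oc1 x) (- oc2 x) (- oc3 x) (- oc4 x) (- oc5 x) (- oc6 x) (- oc7 x)"

text \<open>Multiplication is not associative, so no ring class of the library applies.\<close>

instantiation octonion :: "{one, times}"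
begin

definition "1 = Octonion 1 0 0 0 0 0 0 0"

definition "x * y = Octonion
     (oc0 x * oc0 y - oc1 x * oc1 y - oc2 x * oc2 y - oc3 x * oc3 y
      - oc4 x * oc4 y - oc5 x * oc5 y - oc6 x * oc6 y - oc7 x * oc7 y)
     (oc0 x * oc1 y + oc1 x * oc0 y + oc2 x * oc4 y + oc3 x * oc7 y
      - oc4 x * oc2 y + oc5 x * oc6 y - oc6 x * oc5 y - oc7 x * oc3 y)
     (oc0 x * oc2 y - oc1 x * oc4 y + oc2 x * oc0 y + oc3 x * oc5 y
      + oc4 x * oc1 y - oc5 x * oc3 y + oc6 x * oc7 y - oc7 x * oc6 y)
     (oc0 x * oc3 y - oc1 x * oc7 y - oc2 x * oc5 y + oc3 x * oc0 y
      + oc4 x * oc6 y + oc5 x * oc2 y - oc6 x * oc4 y + oc7 x * oc1 y)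
     (oc0 x * oc4 y + oc1 x * oc2 y - oc2 x * oc1 y - oc3 x * oc6 y
      + oc4 x * oc0 y + oc5 x * oc7 y + oc6 x * oc3 y - oc7 x * oc5 y)
     (oc0 x * oc5 y - oc1 x * oc6 y + oc2 x * oc3 y - oc3 x * oc2 y
      - oc4 x * oc7 y + oc5 x * oc0 y + oc6 x * oc1 y + oc7 x * oc4 y)
     (oc0 x * oc6 y + oc1 x * oc5 y - oc2 x * oc7 y + oc3 x * oc4 y
      - oc4 x * oc3 y - oc5 x * oc1 y + oc6 x * oc0 y + oc7 x * oc2 y)
     (oc0 x * oc7 y + oc1 x * oc3 y + oc2 x * oc6 y - oc3 x * oc1 y
      + oc4 x * oc5 y - oc5 x * oc4 y - oc6 x * oc2 y + oc7 x * oc0 y)"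

instance ..

end

instantiation octonion :: real_vector
begin

definition "0 = Octonion 0 0 0 0 0 0 0 0"

definition "x + y = Octonion
    (oc0 x + oc0 y) (oc1 x + oc1 y) (oc2 x + oc2 y) (oc3 x + oc3 y)
    (oc4 x + oc4 y) (oc5 x + oc5 y) (oc6 x + oc6 y) (oc7 x + oc7 y)"

definition "- x = Octonion
    (- oc0 x) (- oc1 x) (- oc2 x) (- oc3 x)
    (- oc4 x) (- oc5 x) (- oc6 x) (- oc7 x)"

definition "x - y = Octonion
    (oc0 x - oc0 y) (oc1 x - oc1 y) (oc2 x - oc2 y) (oc3 x - oc3 y)
    (oc4 x - oc4 y) (oc5 x - oc5 y) (oc6 x - oc6 y) (oc7 x - oc7 y)"

definition "r *\<^sub>R x = Octonion
    (r * oc0 x) (r * oc1 x) (r * oc2 x) (r * oc3 x)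
    (r * oc4 x) (r * oc5 x) (r * oc6 x) (r * oc7 x)"

instance
  by standard
    (simp_all add: octonion_eq_iff zero_octonion_def plus_octonion_def uminus_octonion_def
      minus_octonion_def scaleR_octonion_def algebra_simps)

end

lemma octonion_sel [simp]:
  "oc0 0 = 0"
  "oc1 0 = 0"
  "oc2 0 = 0"
  "oc3 0 = 0"
  "oc4 0 = 0"
  "oc5 0 = 0"
  "oc6 0 = 0"
  "oc7 0 = 0"
  "oc0 1 = 1"
  "oc1 1 = 0"
  "oc2 1 = 0"
  "oc3 1 = 0"
  "oc4 1 = 0"
  "oc5 1 = 0"
  "oc6 1 = 0"
  "oc7 1 = 0"
  "oc0 (x + y) = oc0 x + oc0 y"
  "oc1 (x + y) = oc1 x + oc1 y"
  "oc2 (x + y) = oc2 x + oc2 y"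
  "oc3 (x + y) = oc3 x + oc3 y"
  "oc4 (x + y) = oc4 x + oc4 y"
  "oc5 (x + y) = oc5 x + oc5 y"
  "oc6 (x + y) = oc6 x + oc6 y"
  "oc7 (x + y) = oc7 x + oc7 y"
  "oc0 (- x) = - oc0 x"
  "oc1 (- x) = - oc1 x"
  "oc2 (- x) = - oc2 x"
  "oc3 (- x) = - oc3 x"
  "oc4 (- x) = - oc4 x"
  "oc5 (- x) = - oc5 x"
  "oc6 (- x) = - oc6 x"
  "oc7 (- x) = - oc7 x"
  "oc0 (x - y) = oc0 x - oc0 y"
  "oc1 (x - y) = oc1 x - oc1 y"
  "oc2 (x - y) = oc2 x - oc2 y"
  "oc3 (x - y) = oc3 x - oc3 y"
  "oc4 (x - y) = oc4 x - oc4 y"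
  "oc5 (x - y) = oc5 x - oc5 y"
  "oc6 (x - y) = oc6 x - oc6 y"
  "oc7 (x - y) = oc7 x - oc7 y"
  "oc0 (r *\<^sub>R x) = r * oc0 x"
  "oc1 (r *\<^sub>R x) = r * oc1 x"
  "oc2 (r *\<^sub>R x) = r * oc2 x"
  "oc3 (r *\<^sub>R x) = r * oc3 x"
  "oc4 (r *\<^sub>R x) = r * oc4 x"
  "oc5 (r *\<^sub>R x) = r * oc5 x"
  "oc6 (r *\<^sub>R x) = r * oc6 x"
  "oc7 (r *\<^sub>R x) = r * oc7 x"
  "oc0 (oconj x) = oc0 x"
  "oc1 (oconj x) = - oc1 x"
  "oc2 (oconj x) = - oc2 x"
  "oc3 (oconj x) = - oc3 x"
  "oc4 (oconj x) = - oc4 x"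
  "oc5 (oconj x) = - oc5 x"
  "oc6 (oconj x) = - oc6 x"
  "oc7 (oconj x) = - oc7 x"
  by (simp_all add: zero_octonion_def one_octonion_def plus_octonion_def uminus_octonion_def
      minus_octonion_def scaleR_octonion_def oconj_def)

lemma octonion_mult_sel:
  "oc0 (x * y) = oc0 x * oc0 y - oc1 x * oc1 y - oc2 x * oc2 y - oc3 x * oc3 y
     - oc4 x * oc4 y - oc5 x * oc5 y - oc6 x * oc6 y - oc7 x * oc7 y"
  "oc1 (x * y) = oc0 x * oc1 y + oc1 x * oc0 y + oc2 x * oc4 y + oc3 x * oc7 y
     - oc4 x * oc2 y + oc5 x * oc6 y - oc6 x * oc5 y - oc7 x * oc3 y"
  "oc2 (x * y) = oc0 x * oc2 y - oc1 x * oc4 y + oc2 x * oc0 y + oc3 x * oc5 y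
     + oc4 x * oc1 y - oc5 x * oc3 y + oc6 x * oc7 y - oc7 x * oc6 y"
  "oc3 (x * y) = oc0 x * oc3 y - oc1 x * oc7 y - oc2 x * oc5 y + oc3 x * oc0 y
     + oc4 x * oc6 y + oc5 x * oc2 y - oc6 x * oc4 y + oc7 x * oc1 y"
  "oc4 (x * y) = oc0 x * oc4 y + oc1 x * oc2 y - oc2 x * oc1 y - oc3 x * oc6 y
     + oc4 x * oc0 y + oc5 x * oc7 y + oc6 x * oc3 y - oc7 x * oc5 y"
  "oc5 (x * y) = oc0 x * oc5 y - oc1 x * oc6 y + oc2 x * oc3 y - oc3 x * oc2 y
     - oc4 x * oc7 y + oc5 x * oc0 y + oc6 x * oc1 y + oc7 x * oc4 y"
  "oc6 (x * y) = oc0 x * oc6 y + oc1 x * oc5 y - oc2 x * oc7 y + oc3 x * oc4 y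
     - oc4 x * oc3 y - oc5 x * oc1 y + oc6 x * oc0 y + oc7 x * oc2 y"
  "oc7 (x * y) = oc0 x * oc7 y + oc1 x * oc3 y + oc2 x * oc6 y - oc3 x * oc1 y
     + oc4 x * oc5 y - oc5 x * oc4 y - oc6 x * oc2 y + oc7 x * oc0 y"
  by (simp_all add: times_octonion_def)

lemma oc0_oconj_mult:
  "oc0 (oconj x * y) = oc0 x * oc0 y + oc1 x * oc1 y + oc2 x * oc2 y + oc3 x * oc3 y +
     oc4 x * oc4 y + oc5 x * oc5 y + oc6 x * oc6 y + oc7 x * oc7 y"
  by (simp add: octonion_mult_sel)

instantiation octonion :: real_inner
begin

definition "inner x y = oc0 (oconj x * y)"
definition "norm (x::octonion) = sqrt (oc0 (oconj x * x))"
definition "sgn (x::octonion) = inverse (norm x) *\<^sub>R x"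
definition "dist (x::octonion) y = norm (x - y)"
definition [code del]: "(uniformity :: (octonion \<times> octonion) filter) =
  (INF e\<in>{0<..}. principal {(x, y). dist x y < e})"
definition [code del]: "open (U :: octonion set) \<longleftrightarrow>
  (\<forall>x\<in>U. eventually (\<lambda>(x', y). x' = x \<longrightarrow> y \<in> U) uniformity)"

instance
proof
  fix x y z :: octonion and r :: real
  show "inner x y = inner y x" "inner (x + y) z = inner x z + inner y z"
    "inner (r *\<^sub>R x) y = r * inner x y"
    by (simp_all add: inner_octonion_def oc0_oconj_mult algebra_simps)
  have *: "inner x x = (oc0 x)\<^sup>2 + (oc1 x)\<^sup>2 + (oc2 x)\<^sup>2 + (oc3 x)\<^sup>2 + (oc4 x)\<^sup>2 + (oc5 x)\<^sup>2
      + (oc6 x)\<^sup>2 + (oc7 x)\<^sup>2"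
    by (simp add: inner_octonion_def oc0_oconj_mult power2_eq_square)
  show "0 \<le> inner x x"
    unfolding * by (intro add_nonneg_nonneg zero_le_power2)
  show "inner x x = 0 \<longleftrightarrow> x = 0"
    unfolding * octonion_eq_iff by (auto simp: add_nonneg_eq_0_iff)
  show "norm x = sqrt (inner x x)"
    by (simp add: inner_octonion_def norm_octonion_def)
qed (rule sgn_octonion_def dist_octonion_def uniformity_octonion_def open_octonion_def)+

end

lemma norm_octonion_sq:
  "(norm x)\<^sup>2 = oc0 x * oc0 x + oc1 x * oc1 x + oc2 x * oc2 x + oc3 x * oc3 x +
     oc4 x * oc4 x + oc5 x * oc5 x + oc6 x * oc6 x + oc7 x * oc7 x"
  by (simp add: power2_norm_eq_inner inner_octonion_def oc0_oconj_mult)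

lemma oconj_mult_self: "oconj x * x = (norm x)\<^sup>2 *\<^sub>R (1::octonion)"
proof -
  have "(norm x)\<^sup>2 = oc0 (oconj x * x)"
    by (simp add: power2_norm_eq_inner inner_octonion_def)
  then show ?thesis
    by (simp add: octonion_eq_iff octonion_mult_sel)
qed

lemma oconj_mult_mult: "oconj x * (x * y) = (norm x)\<^sup>2 *\<^sub>R (y::octonion)"
  unfolding norm_octonion_sq octonion_eq_iff octonion_mult_sel
    octonion_sel
  by (simp add: algebra_simps)

lemma inner_octonion_mult_left: "inner (x * y) z = inner y (oconj x * (z::octonion))"
  unfolding inner_octonion_def oc0_oconj_mult octonion_mult_sel octonion_sel
  by (simp add: algebra_simps)

lemma octonion_norm_mult: "norm (x * y) = norm x * norm (y::octonion)"
proof -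
  have "(norm (x * y))\<^sup>2 = (norm x * norm y)\<^sup>2"
    unfolding power_mult_distrib power2_norm_eq_inner[of "x * y"] power2_norm_eq_inner[of y]
    by (simp add: inner_octonion_mult_left oconj_mult_mult)
  then show ?thesis
    by simp
qed

text \<open>A vector \<open>(x\<^sub>1, x\<^sub>2, x\<^sub>3; \<lambda>\<^sub>1, \<lambda>\<^sub>2, \<lambda>\<^sub>3)\<close> is a pair of type
  \<open>(octonion^3) \<times> (real^3)\<close>.\<close>

definition veronese :: "(octonion^3) \<times> (real^3) \<Rightarrow> bool" where
  "veronese = (\<lambda>(x, l).
     l$1 *\<^sub>R oconj (x$1) = x$2 * x$3 \<and>
     l$2 *\<^sub>R oconj (x$2) = x$3 * x$1 \<and>
     l$3 *\<^sub>R oconj (x$3) = x$1 * x$2 \<and>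
     (norm (x$1))\<^sup>2 = l$2 * l$3 \<and>
     (norm (x$2))\<^sup>2 = l$3 * l$1 \<and>
     (norm (x$3))\<^sup>2 = l$1 * l$2)"

text \<open>The exceptional Jordan algebra: a carrier set and a product on it. The library's matrix
  product is not available here, since it is restricted to associative semirings.\<close>

definition exceptional_jordan :: "(octonion^3^3) set" where
  "exceptional_jordan = {X. \<forall>i j. X$j$i = oconj (X$i$j)}"

definition omat_mult :: "octonion^3^3 \<Rightarrow> octonion^3^3 \<Rightarrow> octonion^3^3" where
  "omat_mult X Y = (\<chi> i j. \<Sum>k\<in>UNIV. X$i$k * Y$k$j)"

definition jordan_prod :: "octonion^3^3 \<Rightarrow> octonion^3^3 \<Rightarrow> octonion^3^3" where
  "jordan_prod X Y = (1/2) *\<^sub>R (omat_mult X Y + omat_mult Y X)"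

definition hermitian_mat :: "(octonion^3) \<times> (real^3) \<Rightarrow> octonion^3^3" where
  "hermitian_mat = (\<lambda>(x, l). vector [
     vector [l$1 *\<^sub>R 1,    x$3,          oconj (x$2)],
     vector [oconj (x$3), l$2 *\<^sub>R 1,    x$1],
     vector [x$2,         oconj (x$1),  l$3 *\<^sub>R 1]])"

definition hermitian_coords :: "octonion^3^3 \<Rightarrow> (octonion^3) \<times> (real^3)" where
  "hermitian_coords X =
     (vector [X$2$3, X$3$1, X$1$2], vector [oc0 (X$1$1), oc0 (X$2$2), oc0 (X$3$3)])"

lemma hermitian_coords_hermitian_mat: "hermitian_coords (hermitian_mat w) = w"
  by (cases w) (simp add: hermitian_coords_def hermitian_mat_def vec_eq_iff forall_3 octonion_eq_iff)

lemma hermitian_mat_in: "hermitian_mat w \<in> exceptional_jordan"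
  by (cases w) (simp add: exceptional_jordan_def hermitian_mat_def forall_3 octonion_eq_iff)

lemma hermitian_mat_hermitian_coords:
  assumes "X \<in> exceptional_jordan"
  shows "hermitian_mat (hermitian_coords X) = X"
proof -
  have h: "X$j$i = oconj (X$i$j)" for i j
    using assms unfolding exceptional_jordan_def by blast
  have "oc0 (X$i$i) *\<^sub>R 1 = X$i$i" for i
    using h[of i i] unfolding octonion_eq_iff octonion_sel by simp
  then show ?thesis
    using h[of 2 1] h[of 1 3] h[of 3 2]
    by (simp add: hermitian_coords_def hermitian_mat_def vec_eq_iff forall_3)
qed

text \<open>The input is read through its Hermitian coordinates, so the map is meaningful only on
  \<open>exceptional_jordan\<close>.\<close>

definition sharp :: "octonion^3^3 \<Rightarrow> octonion^3^3" where
  "sharp X = (case hermitian_coords X of (x, l) \<Rightarrow> vector [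
     vector [(l$2 * l$3 - (norm (x$1))\<^sup>2) *\<^sub>R 1,
             oconj (x$2) * oconj (x$1) - l$3 *\<^sub>R x$3,
             x$3 * x$1 - l$2 *\<^sub>R oconj (x$2)],
     vector [x$1 * x$2 - l$3 *\<^sub>R oconj (x$3),
             (l$1 * l$3 - (norm (x$2))\<^sup>2) *\<^sub>R 1,
             oconj (x$3) * oconj (x$2) - l$1 *\<^sub>R x$1],
     vector [oconj (x$1) * oconj (x$3) - l$2 *\<^sub>R x$2,
             x$2 * x$3 - l$1 *\<^sub>R oconj (x$1),
             (l$1 * l$2 - (norm (x$3))\<^sup>2) *\<^sub>R 1]])"

text \<open>In Jordan terms, \<open>X\<^sup>\<sharp> = X\<^sup>2 - tr(X) X + ((tr X)\<^sup>2 - tr(X\<^sup>2))/2 I\<close>.\<close>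

lemma sharp_eq_jordan:
  assumes "X \<in> exceptional_jordan"
  defines "tr \<equiv> (\<lambda>Y::octonion^3^3. oc0 (Y$1$1) + oc0 (Y$2$2) + oc0 (Y$3$3))"
  shows "sharp X = jordan_prod X X - tr X *\<^sub>R X
    + (((tr X)\<^sup>2 - tr (jordan_prod X X)) / 2) *\<^sub>R (\<chi> i j. if i = j then 1 else 0)"
proof -
  obtain x l where X: "X = hermitian_mat (x, l)"
    using hermitian_mat_hermitian_coords[OF assms(1)] by (metis surj_pair)
  have c: "hermitian_coords X = (x, l)"
    by (simp add: X hermitian_coords_hermitian_mat)
  show ?thesis
    unfolding sharp_def c tr_def norm_octonion_sq
    by (simp add: X hermitian_mat_def jordan_prod_def omat_mult_def sum_3 vec_eq_iff forall_3
        octonion_eq_iff octonion_mult_sel power2_eq_square)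
      (simp_all add: field_simps)
qed

definition rank_one :: "octonion^3^3 \<Rightarrow> bool" where
  "rank_one X \<longleftrightarrow> X \<in> exceptional_jordan \<and> X \<noteq> 0 \<and> sharp X = 0"

end

theory Submission imports Defs begin

lemma oconj_oconj [simp]: "oconj (oconj x) = x"
  by (simp add: octonion_eq_iff)

lemma oconj_scaleR: "oconj (r *\<^sub>R x) = r *\<^sub>R oconj x"
  by (simp add: octonion_eq_iff)

lemma oconj_mult: "oconj (x * y) = oconj y * oconj x"
  by (simp add: octonion_eq_iff octonion_mult_sel)

lemma oconj_mult_oconj_eq_scaleR_iff:
  "oconj y * oconj x = r *\<^sub>R z \<longleftrightarrow> r *\<^sub>R oconj z = x * y"
  by (metis oconj_mult oconj_oconj oconj_scaleR)

lemma octonion_one_neq_zero: "(1::octonion) \<noteq> 0"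
  by (simp add: octonion_eq_iff)

lemma veronese_iff_sharp_eq_0: "veronese w \<longleftrightarrow> sharp (hermitian_mat w) = 0"
proof (cases w)
  case (Pair x l)
  show ?thesis
    unfolding veronese_def sharp_def hermitian_coords_hermitian_mat Pair
    by (auto simp: vec_eq_iff forall_3 octonion_one_neq_zero
        oconj_mult_oconj_eq_scaleR_iff mult.commute)
qed

lemma hermitian_mat_eq_0_iff: "hermitian_mat w = 0 \<longleftrightarrow> w = 0"
proof
  have coords: "hermitian_coords 0 = 0"
    by (simp add: hermitian_coords_def zero_prod_def vec_eq_iff forall_3)
  show "w = 0" if "hermitian_mat w = 0"
    using hermitian_coords_hermitian_mat[of w] that coords by simp
  show "hermitian_mat w = 0" if "w = 0"
    using that by (simp add: hermitian_mat_def zero_prod_def vec_eq_iff forall_3 octonion_eq_iff)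
qed

theorem mainTheorem1:
  fixes w :: "(octonion^3) \<times> (real^3)"
  assumes "w \<noteq> 0"
  shows "(veronese w \<longleftrightarrow> sharp (hermitian_mat w) = 0) \<and>
         (veronese w \<longleftrightarrow> rank_one (hermitian_mat w))"
  using assms
  by (simp add: veronese_iff_sharp_eq_0 rank_one_def hermitian_mat_in hermitian_mat_eq_0_iff)

end
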